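(* Let $\lambda>0$, let $\mathcal{O}$ (original) and $\mathcal{S}$ (synthetic) be two finite labelled datasets, and let $P_{\mathcal{O}},P_{\mathcal{S}}$ be the associated $L_2$-regularized empirical risk objectives and $D_{\mathcal{S}}$ the dual objective for $\mathcal{S}$ (all as defined in the context). Suppose $P_{\mathcal{O}}$ and $P_{\mathcal{S}}$ are $\lambda$-strongly convex with respect to $\boldsymbol{\theta}$. Let $\boldsymbol{\theta}_{\mathcal{O}}^*$ be the unique minimizer of $P_{\mathcal{O}}$ and $\boldsymbol{\theta}_{\mathcal{S}}^*$ the unique minimizer of $P_{\mathcal{S}}$. For any feasible dual variable $\tilde{\boldsymbol{\alpha}}_{\mathcal{S}}\in\mathrm{dom}(D_{\mathcal{S}})$ define the duality gap $$G_{\mathcal{S}}(\boldsymbol{\theta}_{\mathcal{O}}^*,\tilde{\boldsymbol{\alpha}}_{\mathcal{S}}):=P_{\mathcal{S}}(\boldsymbol{\theta}_{\mathcal{O}}^* )-D_{\mathcal{S}}(\tilde{\boldsymbol{\alpha}}_{\mathcal{S}}).$$ Then $$\|\boldsymbol{\theta}_{\mathcal{O}}^*-\boldsymbol{\theta}_{\mathcal{S}}^*\|_2^2\le\frac{2}{\lambda}\,G_{\mathcal{S}}(\boldsymbol{\theta}_{\mathcal{O}}^*,\tilde{\boldsymbol{\alpha}}_{\mathcal{S}}).$$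
   Context: Let $\mathcal{H}$ be a real Hilbert space (a reproducing kernel Hilbert space), $\boldsymbol{\phi}:\mathbb{R}^d\to\mathcal{H}$ a feature map, and $k(\boldsymbol{x},\boldsymbol{x}')=\boldsymbol{\phi}(\boldsymbol{x})^\top\boldsymbol{\phi}(\boldsymbol{x}')$ the kernel, where $\boldsymbol{a}^\top\boldsymbol{b}$ denotes the inner product of $\mathcal{H}$ and $\|\cdot\|_2$ its norm. The model with parameter $\boldsymbol{\theta}\in\mathcal{H}$ is $f(\boldsymbol{x};\boldsymbol{\theta})=\boldsymbol{\phi}(\boldsymbol{x})^\top\boldsymbol{\theta}$. The loss $\ell(y,t)$ is a real-valued function of a label $y$ and a real prediction $t$, convex and continuous in $t$. The original dataset is $\mathcal{O}=\{(\boldsymbol{x}_i^{\mathcal{O}},y_i^{\mathcal{O}})\}_{i=1}^{n_{\mathcal{O}}}$ with $\boldsymbol{x}_i^{\mathcal{O}}\in\mathbb{R}^d$, $y_i^{\mathcal{O}}\in\{-1,+1\}$; the synthetic dataset is $\mathcal{S}=\{(\boldsymbol{x}_i^{\mathcal{S}},y_i^{\mathcal{S}})\}_{i=1}^{n_{\mathcal{S}}}$ with $\boldsymbol{x}_i^{\mathcal{S}}\in\mathbb{R}^d$, $y_i^{\mathcal{S}}\in\mathbb{R}$. For $\mathcal{D}\in\{\mathcal{O},\mathcal{S}\}$ the primal objective is $$P_{\mathcal{D}}(\boldsymbol{\theta})=\sum_{i=1}^{n_{\mathcal{D}}}\ell(y_i^{\mathcal{D}},f(\boldsymbol{x}_i^{\mathcal{D}};\boldsymbol{\theta}))+\frac{\lambda}{2}\|\boldsymbol{\theta}\|_2^2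 .$$ The dual objective for $\mathcal{S}$ is, for $\boldsymbol{\alpha}\in\mathbb{R}^{n_{\mathcal{S}}}$, $$D_{\mathcal{S}}(\boldsymbol{\alpha})=-\sum_{i=1}^{n_{\mathcal{S}}}\ell^*(y_i^{\mathcal{S}},-y_i^{\mathcal{S}}\alpha_i)-\frac{1}{2\lambda}\sum_{i=1}^{n_{\mathcal{S}}}\sum_{j=1}^{n_{\mathcal{S}}}\alpha_i\alpha_j\,y_i^{\mathcal{S}}y_j^{\mathcal{S}}\,k(\boldsymbol{x}_i^{\mathcal{S}},\boldsymbol{x}_j^{\mathcal{S}}),$$ where $\ell^*(y,s)=\sup_{t\in\mathbb{R}}\{st-\ell(y,t)\}$ is the convex conjugate in the second argument, and $\mathrm{dom}(D_{\mathcal{S}})=\{\boldsymbol{\alpha}:D_{\mathcal{S}}(\boldsymbol{\alpha})>-\infty\}$ is the set of feasible dual variables. A convex function $F$ with nonempty domain is $\lambda$-strongly convex if for all $\boldsymbol{\theta},\boldsymbol{\theta}'\in\mathrm{dom}(F)$ and every subgradient $\boldsymbol{g}\in\partial F(\boldsymbol{\theta}')$ one has $F(\boldsymbol{\theta})-F(\boldsymbol{\theta}')\ge\boldsymbol{g}^\top(\boldsymbol{\theta}-\boldsymbol{\theta}')+\frac{\lambda}{2}\|\boldsymbol{\theta}-\boldsymbol{\theta}'\|_2^2$. *)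

theory Defs
  imports "HOL-Analysis.Analysis"
begin

text \<open>
  A real Hilbert space is a type of sort \<open>{real_inner, complete_space}\<close>.  A dataset of \<open>n\<close> labelled
  points is a list of length \<open>n\<close> of pairs (input, label); accordingly \<open>\<real>\<^sup>n\<close>, with \<open>n\<close> the size
  of a dataset, is the set of real lists of length \<open>n\<close>.  Indices run from \<open>0\<close> to \<open>n - 1\<close>.
\<close>

type_synonym 'd dataset = "((real ^ 'd) \<times> real) list"

definition kernel :: "(real ^ 'd \<Rightarrow> 'h::real_inner) \<Rightarrow> real ^ 'd \<Rightarrow> real ^ 'd \<Rightarrow> real" where
  "kernel \<phi> x x' = inner (\<phi> x) (\<phi> x')"

definition model :: "(real ^ 'd \<Rightarrow> 'h::real_inner) \<Rightarrow> real ^ 'd \<Rightarrow> 'h \<Rightarrow> real" where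
  "model \<phi> x \<theta> = inner (\<phi> x) \<theta>"

definition primal_objective ::
    "(real \<Rightarrow> real \<Rightarrow> real) \<Rightarrow> (real ^ 'd \<Rightarrow> 'h::real_inner) \<Rightarrow> real \<Rightarrow> 'd dataset \<Rightarrow> 'h \<Rightarrow> real" where
  "primal_objective loss \<phi> lam D \<theta> =
     (\<Sum>i<length D. loss (snd (D ! i)) (model \<phi> (fst (D ! i)) \<theta>)) + lam / 2 * (norm \<theta>)\<^sup>2"

definition conjugate :: "(real \<Rightarrow> real \<Rightarrow> real) \<Rightarrow> real \<Rightarrow> real \<Rightarrow> ereal" where
  "conjugate loss y s = (SUP t. ereal (s * t - loss y t))"

text \<open>
  The conjugate of a real-valued loss never takes the value \<open>-\<infinity>\<close>, so no undefined difference of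
  infinities arises in the following sum, and the dual objective never takes the value \<open>\<infinity>\<close>.
\<close>

definition dual_objective ::
    "(real \<Rightarrow> real \<Rightarrow> real) \<Rightarrow> (real ^ 'd \<Rightarrow> 'h::real_inner) \<Rightarrow> real \<Rightarrow> 'd dataset \<Rightarrow> real list \<Rightarrow> ereal" where
  "dual_objective loss \<phi> lam D \<alpha> =
     - (\<Sum>i<length D. conjugate loss (snd (D ! i)) (- (snd (D ! i) * \<alpha> ! i)))
     - ereal (1 / (2 * lam) *
         (\<Sum>i<length D. \<Sum>j<length D.
            \<alpha> ! i * \<alpha> ! j * snd (D ! i) * snd (D ! j) * kernel \<phi> (fst (D ! i)) (fst (D ! j))))"

definition dual_dom ::
    "(real \<Rightarrow> real \<Rightarrow> real) \<Rightarrow> (real ^ 'd \<Rightarrow> 'h::real_inner) \<Rightarrow> real \<Rightarrow> 'd dataset \<Rightarrow> real list set" where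
  "dual_dom loss \<phi> lam D = {\<alpha>. length \<alpha> = length D \<and> dual_objective loss \<phi> lam D \<alpha> > -\<infinity>}"

definition duality_gap ::
    "(real \<Rightarrow> real \<Rightarrow> real) \<Rightarrow> (real ^ 'd \<Rightarrow> 'h::real_inner) \<Rightarrow> real \<Rightarrow> 'd dataset \<Rightarrow> 'h \<Rightarrow> real list \<Rightarrow> ereal" where
  "duality_gap loss \<phi> lam D \<theta> \<alpha> = ereal (primal_objective loss \<phi> lam D \<theta>) - dual_objective loss \<phi> lam D \<alpha>"

text \<open>
  As with \<^const>\<open>convex_on\<close>, an extended-real-valued function that never takes the value \<open>-\<infinity>\<close> is
  represented by its effective domain \<open>S\<close> together with a real-valued function on \<open>S\<close>.
\<close>

definition subdifferential :: "'h::real_inner set \<Rightarrow> ('h \<Rightarrow> real) \<Rightarrow> 'h \<Rightarrow> 'h set" where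
  "subdifferential S F \<theta>' = {g. \<forall>\<theta>\<in>S. F \<theta> \<ge> F \<theta>' + inner g (\<theta> - \<theta>')}"

definition strongly_convex_on :: "'h::real_inner set \<Rightarrow> real \<Rightarrow> ('h \<Rightarrow> real) \<Rightarrow> bool" where
  "strongly_convex_on S lam F \<longleftrightarrow>
     S \<noteq> {} \<and> convex_on S F \<and>
     (\<forall>\<theta>\<in>S. \<forall>\<theta>'\<in>S. \<forall>g\<in>subdifferential S F \<theta>'.
        F \<theta> - F \<theta>' \<ge> inner g (\<theta> - \<theta>') + lam / 2 * (norm (\<theta> - \<theta>'))\<^sup>2)"

definition is_unique_minimizer :: "('a \<Rightarrow> real) \<Rightarrow> 'a \<Rightarrow> bool" where
  "is_unique_minimizer F \<theta> \<longleftrightarrow>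
     is_arg_min F (\<lambda>_. True) \<theta> \<and> (\<forall>\<theta>'. is_arg_min F (\<lambda>_. True) \<theta>' \<longrightarrow> \<theta>' = \<theta>)"

end

theory Submission
  imports Defs
begin

text \<open>
  Zero is a subgradient of \<open>P\<^sub>S\<close> at its minimizer, so strong convexity bounds
  \<open>\<lambda> / 2 * \<parallel>\<theta>\<^sub>O - \<theta>\<^sub>S\<parallel>\<^sup>2\<close> by \<open>P\<^sub>S(\<theta>\<^sub>O) - P\<^sub>S(\<theta>\<^sub>S)\<close>; weak duality
  \<open>D\<^sub>S(\<alpha>) \<le> P\<^sub>S(\<theta>\<^sub>S)\<close> bounds that difference by the gap.  With
  \<open>w = (\<Sum>i. \<alpha>\<^sub>i y\<^sub>i \<phi>(x\<^sub>i))\<close>, weak duality is Young's inequality for the conjugate at each data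
  point, summed, together with \<open>inner w \<theta> \<le> \<lambda> / 2 * \<parallel>\<theta>\<parallel>\<^sup>2 + 1 / (2\<lambda>) * \<parallel>w\<parallel>\<^sup>2\<close>.
\<close>

lemma conjugate_ge: "ereal (s * t - loss y t) \<le> conjugate loss y s"
  unfolding conjugate_def by (rule SUP_upper) simp

text \<open>Expand the squared norm of \<open>lam *\<^sub>R \<theta> - w\<close>, which is
  nonnegative, and divide by \<open>2 * lam\<close>.\<close>

lemma inner_le_weighted_norms:
  fixes w \<theta> :: "'h::real_inner"
  assumes "lam > 0"
  shows "inner w \<theta> \<le> lam / 2 * (norm \<theta>)\<^sup>2 + 1 / (2 * lam) * (norm w)\<^sup>2"
proof -
  have "0 \<le> inner (lam *\<^sub>R \<theta> - w) (lam *\<^sub>R \<theta> - w)"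
    by simp
  also have "\<dots> = lam\<^sup>2 * (norm \<theta>)\<^sup>2 - 2 * lam * inner w \<theta> + (norm w)\<^sup>2"
    unfolding power2_norm_eq_inner
    by (simp add: inner_diff_left inner_diff_right inner_commute power2_eq_square algebra_simps)
  finally show ?thesis
    using assms by (simp add: field_simps power2_eq_square)
qed

text \<open>The kernel values are the Gram matrix of the feature vectors, so bilinearity collapses
  the dual's double sum.\<close>

lemma quadratic_form_kernel:
  fixes \<phi> :: "real ^ 'd \<Rightarrow> 'h::real_inner"
  shows "(\<Sum>i<length D. \<Sum>j<length D.
      \<alpha> ! i * \<alpha> ! j * snd (D ! i) * snd (D ! j) * kernel \<phi> (fst (D ! i)) (fst (D ! j)))
    = (norm (\<Sum>i<length D. (\<alpha> ! i * snd (D ! i)) *\<^sub>R \<phi> (fst (D ! i))))\<^sup>2"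
  unfolding power2_norm_eq_inner inner_sum_left inner_sum_right kernel_def
  by (intro sum.cong refl) (simp add: mult_ac inner_commute)

lemma weak_duality:
  fixes \<phi> :: "real ^ 'd \<Rightarrow> 'h::real_inner"
  assumes "lam > 0"
  shows "dual_objective loss \<phi> lam D \<alpha> \<le> ereal (primal_objective loss \<phi> lam D \<theta>)"
proof -
  define y where "y i = snd (D ! i)" for i
  define t where "t i = model \<phi> (fst (D ! i)) \<theta>" for i
  define w where "w = (\<Sum>i<length D. (\<alpha> ! i * y i) *\<^sub>R \<phi> (fst (D ! i)))"
  \<comment> \<open>Each conjugate is a supremum over predictions; taking the prediction
    \<open>t i\<close> made by \<theta> gives \<open>c\<close>, a finite lower bound for their sum
    even if that sum is infinite.\<close>
  define c where "c = (\<Sum>i<length D. - (y i * \<alpha> ! i) * t i - loss (y i) (t i))"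
  have "inner w \<theta> = (\<Sum>i<length D. y i * \<alpha> ! i * t i)"
    unfolding w_def t_def model_def by (simp add: inner_sum_left mult_ac)
  then have "c = - inner w \<theta> - (\<Sum>i<length D. loss (y i) (t i))"
    by (simp add: c_def sum_subtractf sum_negf)
  \<comment> \<open>In \<open>- c\<close> the losses reappear next to
    \<open>inner w \<theta>\<close>; bounding the latter cancels the \<open>w\<close> term and
    leaves the regularizer.\<close>
  then have real_bound: "- c - 1 / (2 * lam) * (norm w)\<^sup>2 \<le> primal_objective loss \<phi> lam D \<theta>"
    using inner_le_weighted_norms[OF assms, of w \<theta>]
    by (simp add: primal_objective_def y_def t_def)
  have "ereal c \<le> (\<Sum>i<length D. conjugate loss (y i) (- (y i * \<alpha> ! i)))"
    unfolding c_def sum_ereal[symmetric] by (intro sum_mono conjugate_ge)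
  then have "- (\<Sum>i<length D. conjugate loss (y i) (- (y i * \<alpha> ! i))) \<le> - ereal c"
    by (simp only: ereal_minus_le_minus)
  then have "dual_objective loss \<phi> lam D \<alpha> \<le> - ereal c - ereal (1 / (2 * lam) * (norm w)\<^sup>2)"
    unfolding dual_objective_def quadratic_form_kernel y_def w_def
    by (rule ereal_minus_mono) simp
  also have "\<dots> = ereal (- c - 1 / (2 * lam) * (norm w)\<^sup>2)"
    by simp
  finally show ?thesis
    using real_bound by (meson ereal_less_eq(3) order_trans)
qed

lemma strongly_convex_minimizer:
  assumes "strongly_convex_on UNIV lam F" "is_arg_min F (\<lambda>_. True) \<theta>'"
  shows "lam / 2 * (norm (\<theta> - \<theta>'))\<^sup>2 \<le> F \<theta> - F \<theta>'"
proof -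
  have "0 \<in> subdifferential UNIV F \<theta>'"
    using assms(2) by (simp add: subdifferential_def is_arg_min_linorder)
  then show ?thesis
    using assms(1) unfolding strongly_convex_on_def by fastforce
qed

theorem theorem3p2:
  fixes \<phi> :: "real ^ 'd \<Rightarrow> 'h::{real_inner, complete_space}"
    and loss :: "real \<Rightarrow> real \<Rightarrow> real"
    and lam :: real
    and Orig Syn :: "'d dataset"
    and \<theta>\<^sub>O \<theta>\<^sub>S :: 'h
    and \<alpha> :: "real list"
  assumes "lam > 0"
    and "\<And>y. convex_on UNIV (loss y)"
    and "\<And>y. continuous_on UNIV (loss y)"
    and "\<And>x y. (x, y) \<in> set Orig \<Longrightarrow> y \<in> {-1, 1}"
    and "strongly_convex_on UNIV lam (primal_objective loss \<phi> lam Orig)"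
    and "strongly_convex_on UNIV lam (primal_objective loss \<phi> lam Syn)"
    and "is_unique_minimizer (primal_objective loss \<phi> lam Orig) \<theta>\<^sub>O"
    and "is_unique_minimizer (primal_objective loss \<phi> lam Syn) \<theta>\<^sub>S"
    and "\<alpha> \<in> dual_dom loss \<phi> lam Syn"
  shows "ereal ((norm (\<theta>\<^sub>O - \<theta>\<^sub>S))\<^sup>2) \<le> ereal (2 / lam) * duality_gap loss \<phi> lam Syn \<theta>\<^sub>O \<alpha>"
proof -
  let ?P = "primal_objective loss \<phi> lam Syn"
  have le: "dual_objective loss \<phi> lam Syn \<alpha> \<le> ereal (?P \<theta>\<^sub>S)"
    by (rule weak_duality[OF assms(1)])
  moreover have "dual_objective loss \<phi> lam Syn \<alpha> > - \<infinity>"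
    using assms(9) by (simp add: dual_dom_def)
  \<comment> \<open>Weak duality excludes \<infinity> and feasibility excludes
    \<open>-\<infinity>\<close>, so the rest is real arithmetic.\<close>
  ultimately obtain d where d: "dual_objective loss \<phi> lam Syn \<alpha> = ereal d"
    by (cases "dual_objective loss \<phi> lam Syn \<alpha>") auto
  have "lam / 2 * (norm (\<theta>\<^sub>O - \<theta>\<^sub>S))\<^sup>2 \<le> ?P \<theta>\<^sub>O - ?P \<theta>\<^sub>S"
    using assms(6,8) by (intro strongly_convex_minimizer) (auto simp: is_unique_minimizer_def)
  then have "lam / 2 * (norm (\<theta>\<^sub>O - \<theta>\<^sub>S))\<^sup>2 \<le> ?P \<theta>\<^sub>O - d"
    using le d by simp
  then have "(norm (\<theta>\<^sub>O - \<theta>\<^sub>S))\<^sup>2 \<le> 2 / lam * (?P \<theta>\<^sub>O - d)"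
    using assms(1) by (simp add: field_simps)
  then show ?thesis
    by (simp add: duality_gap_def d)
qed

end
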